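(* Let $F$ be a field of characteristic different from $2$ and let $J_2$ be the Jordan algebra of the two-dimensional vector space with non-degenerate symmetric bilinear form, with basis $\{1,e_1,e_2\}$ and commutative multiplication in which $1$ is the unit, $e_1^2=e_2^2=1$, $e_1e_2=0$. Then the polynomial of degree $8$ \[ w(x,y)=[[x,y],x][x,y][[x,y],y]-[[x,y],y][x,y][[x,y],x]+2[x,y]^4 \] is an essential weak central polynomial for the pair $({\mathcal M}(J_2),{\mathcal R}(J_2))$, with $w(r(e_1),r(e_2))=2\,\mathrm{id}_{J_2}$, and $w(x,y)$ is not a central polynomial for the algebra ${\mathcal M}(J_2)\cong M_3(F)$.
   Context: ${\mathcal R}(J_2)\subset\mathrm{End}_F(J_2)$ is the span of the multiplication operators $r(a):u\mapsto ua$, $a\in J_2$, and ${\mathcal M}(J_2)$ is the associative subalgebra of $\mathrm{End}_F(J_2)$ generated by it. $[x,y]=xy-yx$ in the free associative algebra. For an associative algebra $R$ generated by a subspace $V$, a polynomial in the free associative algebra is an essential weak central polynomial for the pair $(R,V)$ if all its evaluations on elements of $V$ lie in the center of $R$ and at least one such evaluation is nonzero; it is a central polynomial for the algebra $R$ if this holds with $V=R$. *)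

theory Defs
  imports "HOL-Analysis.Analysis" "HOL-Library.Poly_Mapping"
begin

section \<open>The free associative algebra\<close>

text \<open>Words are wrapped in a type of their own so that concatenation can be the addition that
  \<open>Poly_Mapping\<close> expects of exponents. The convolution product of
  \<open>'x word \<Rightarrow>\<^sub>0 'f\<close> is then the product of the (unital) free associative
  algebra over \<open>'f\<close> on the generators \<open>'x\<close>.\<close>

datatype 'x word = Word (letters: "'x list")

instantiation word :: (type) monoid_add
begin

definition zero_word :: "'a word" where "0 = Word []"

definition plus_word :: "'a word \<Rightarrow> 'a word \<Rightarrow> 'a word"
  where "u + v = Word (letters u @ letters v)"

instance
  by standard (simp_all add: zero_word_def plus_word_def)

end

type_synonym ('x, 'f) free_alg = "'x word \<Rightarrow>\<^sub>0 'f"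

definition var :: "'x \<Rightarrow> ('x, 'f::field) free_alg"
  where "var x = Poly_Mapping.single (Word [x]) 1"

text \<open>The zero polynomial gets degree 0.\<close>

definition free_degree :: "('x, 'f::field) free_alg \<Rightarrow> nat"
  where "free_degree p = Max (insert 0 ((length \<circ> letters) ` Poly_Mapping.keys p))"

definition comm :: "'r::ring \<Rightarrow> 'r \<Rightarrow> 'r"
  where "comm a b = a * b - b * a"


section \<open>Weak central polynomials\<close>

text \<open>An associative algebra over \<open>'f\<close> is given by a subset of a ring type \<open>'r\<close>
  and a scalar action \<open>sc\<close> of \<open>'f\<close> on \<open>'r\<close>.
  The subset need not contain \<open>1 :: 'r\<close>, and a constant term is evaluated as a
  multiple of that \<open>1\<close>, so evaluation stays in the algebra if it contains
  \<open>1\<close> or the polynomial has no constant term.\<close>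

definition eval_free :: "('f::field \<Rightarrow> 'r::ring_1 \<Rightarrow> 'r) \<Rightarrow> ('x \<Rightarrow> 'r) \<Rightarrow> ('x, 'f) free_alg \<Rightarrow> 'r"
  where "eval_free sc \<phi> p =
    (\<Sum>u\<in>Poly_Mapping.keys p. sc (Poly_Mapping.lookup p u) (prod_list (map \<phi> (letters u))))"

definition subalgebra :: "('f::field \<Rightarrow> 'r::ring_1 \<Rightarrow> 'r) \<Rightarrow> 'r set \<Rightarrow> bool"
  where "subalgebra sc A \<longleftrightarrow> module.subspace sc A \<and> (\<forall>a\<in>A. \<forall>b\<in>A. a * b \<in> A)"

definition generated_subalgebra :: "('f::field \<Rightarrow> 'r::ring_1 \<Rightarrow> 'r) \<Rightarrow> 'r set \<Rightarrow> 'r set"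
  where "generated_subalgebra sc V = subalgebra sc hull V"

definition center_of :: "'r::ring_1 set \<Rightarrow> 'r set"
  where "center_of R = {z \<in> R. \<forall>a\<in>R. z * a = a * z}"

definition essential_weak_central ::
    "('f::field \<Rightarrow> 'r::ring_1 \<Rightarrow> 'r) \<Rightarrow> 'r set \<Rightarrow> 'r set \<Rightarrow> ('x, 'f) free_alg \<Rightarrow> bool"
  where "essential_weak_central sc R V p \<longleftrightarrow>
    (\<forall>\<phi>. range \<phi> \<subseteq> V \<longrightarrow> eval_free sc \<phi> p \<in> center_of R) \<and>
    (\<exists>\<phi>. range \<phi> \<subseteq> V \<and> eval_free sc \<phi> p \<noteq> 0)"

definition central_polynomial ::
    "('f::field \<Rightarrow> 'r::ring_1 \<Rightarrow> 'r) \<Rightarrow> 'r set \<Rightarrow> ('x, 'f) free_alg \<Rightarrow> bool"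
  where "central_polynomial sc R p \<longleftrightarrow> essential_weak_central sc R R p"


section \<open>Linear endomorphisms\<close>

typedef (overloaded) ('f::field, 'n::finite) endo =
    "{T :: 'f ^ 'n \<Rightarrow> 'f ^ 'n. Vector_Spaces.linear (*s) (*s) T}"
  morphisms apply_endo Endo
  using vec.linear_id by blast

setup_lifting type_definition_endo

instantiation endo :: (field, finite) ring_1
begin

lift_definition zero_endo :: "('a, 'b) endo" is "\<lambda>u. 0"
  by (rule vec.linear_zero)

lift_definition one_endo :: "('a, 'b) endo" is "\<lambda>u. u"
  by (rule vec.linear_ident)

lift_definition plus_endo :: "('a, 'b) endo \<Rightarrow> ('a, 'b) endo \<Rightarrow> ('a, 'b) endo"
  is "\<lambda>S T u. S u + T u"
  by (rule vec.linear_compose_add)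

lift_definition minus_endo :: "('a, 'b) endo \<Rightarrow> ('a, 'b) endo \<Rightarrow> ('a, 'b) endo"
  is "\<lambda>S T u. S u - T u"
  by (rule vec.linear_compose_sub)

lift_definition uminus_endo :: "('a, 'b) endo \<Rightarrow> ('a, 'b) endo"
  is "\<lambda>T u. - T u"
  by (rule vec.linear_compose_neg)

lift_definition times_endo :: "('a, 'b) endo \<Rightarrow> ('a, 'b) endo \<Rightarrow> ('a, 'b) endo"
  is "\<lambda>S T. S \<circ> T"
  by (rule Vector_Spaces.linear_compose)

instance
proof
  show "(0 :: ('a, 'b) endo) \<noteq> 1"
  proof (transfer, rule notI)
    assume "(\<lambda>u :: 'a ^ 'b. 0 :: 'a ^ 'b) = (\<lambda>u. u)"
    then have "(1 :: 'a ^ 'b) = 0" by metis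
    then show False by (simp add: vec_eq_iff)
  qed
qed (transfer; simp add: fun_eq_iff algebra_simps vec.linear_add vec.linear_diff)+

end

lift_definition scale_endo :: "'f::field \<Rightarrow> ('f, 'n::finite) endo \<Rightarrow> ('f, 'n) endo"
  is "\<lambda>c T u. c *s T u"
  by (rule vec.linear_compose_scale_right)

interpretation endo: vector_space "scale_endo :: 'f::field \<Rightarrow> ('f, 'n::finite) endo \<Rightarrow> ('f, 'n) endo"
  by standard (transfer; simp add: fun_eq_iff vec.scale_right_distrib vec.scale_left_distrib)+


section \<open>The Jordan algebra and its multiplication algebra\<close>

text \<open>\<open>u $ 1\<close> is the coordinate at the unit, \<open>u $ 2\<close> and \<open>u $ 3\<close> are
  the coordinates at the orthonormal vectors \<open>e1\<close> and \<open>e2\<close>. The product is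
  \<open>(\<alpha> + v)(\<beta> + w) = (\<alpha> \<beta> + \<langle>v, w\<rangle>) + (\<alpha> w + \<beta> v)\<close>.\<close>

definition j_one :: "'f::field ^ 3" where "j_one = axis 1 1"
definition e1 :: "'f::field ^ 3" where "e1 = axis 2 1"
definition e2 :: "'f::field ^ 3" where "e2 = axis 3 1"

definition jmult :: "'f::field ^ 3 \<Rightarrow> 'f ^ 3 \<Rightarrow> 'f ^ 3" (infixl "\<bullet>\<^sub>J" 70)
  where "u \<bullet>\<^sub>J v = vector
    [u $ 1 * v $ 1 + u $ 2 * v $ 2 + u $ 3 * v $ 3,
     u $ 1 * v $ 2 + u $ 2 * v $ 1,
     u $ 1 * v $ 3 + u $ 3 * v $ 1]"

lemma jmult_linear_left: "Vector_Spaces.linear (*s) (*s) (\<lambda>u. u \<bullet>\<^sub>J (a :: 'f::field ^ 3))"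
  by (simp add: Vector_Spaces.linear_iff vec.vector_space_axioms jmult_def vec_eq_iff
      forall_3 algebra_simps)

lemma jmult_commute: "u \<bullet>\<^sub>J v = v \<bullet>\<^sub>J u"
  by (simp add: jmult_def vec_eq_iff forall_3 algebra_simps)

lemma jmult_one: "j_one \<bullet>\<^sub>J u = u"
  by (simp add: jmult_def j_one_def vec_eq_iff forall_3 axis_def)

lemma jmult_basis:
  "e1 \<bullet>\<^sub>J e1 = j_one" "e2 \<bullet>\<^sub>J e2 = j_one" "e1 \<bullet>\<^sub>J e2 = 0"
  by (simp_all add: jmult_def j_one_def e1_def e2_def vec_eq_iff forall_3 axis_def)

lemma jordan_identity: "(u \<bullet>\<^sub>J v) \<bullet>\<^sub>J (u \<bullet>\<^sub>J u) = u \<bullet>\<^sub>J (v \<bullet>\<^sub>J (u \<bullet>\<^sub>J u))"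
  by (simp add: jmult_def vec_eq_iff forall_3 algebra_simps)

lift_definition rmult :: "'f::field ^ 3 \<Rightarrow> ('f, 3) endo" is "\<lambda>a u. u \<bullet>\<^sub>J a"
  by (rule jmult_linear_left)

definition R_J2 :: "('f::field, 3) endo set"
  where "R_J2 = module.span scale_endo (range rmult)"

definition M_J2 :: "('f::field, 3) endo set"
  where "M_J2 = generated_subalgebra scale_endo R_J2"

definition iso_matrix_algebra :: "('f::field, 'n::finite) endo set \<Rightarrow> ('f ^ 'm ^ 'm::finite) itself \<Rightarrow> bool"
  where "iso_matrix_algebra A _ \<longleftrightarrow> (\<exists>\<Phi> :: ('f, 'n) endo \<Rightarrow> 'f ^ 'm ^ 'm.
    bij_betw \<Phi> A UNIV \<and>
    (\<forall>S\<in>A. \<forall>T\<in>A. \<Phi> (S + T) = \<Phi> S + \<Phi> T) \<and>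
    (\<forall>c. \<forall>T\<in>A. \<Phi> (scale_endo c T) = (\<chi> i j. c * \<Phi> T $ i $ j)) \<and>
    (\<forall>S\<in>A. \<forall>T\<in>A. \<Phi> (S * T) = \<Phi> S ** \<Phi> T))"


section \<open>The polynomial\<close>

datatype xy = X | Y

definition w_poly :: "(xy, 'f::field) free_alg"
  where "w_poly = (let x = var X; y = var Y; c = comm x y in
    comm c x * c * comm c y - comm c y * c * comm c x + 2 * c ^ 4)"

end

theory Submission
  imports Defs
begin

section \<open>Evaluation in associative algebras\<close>

text \<open>Let \<open>x = rmult a\<close>, \<open>y = rmult b\<close> and d = a2 b3 - a3 b2 in the
  coordinates of the code. The commutator c = [x, y] kills the unit and acts on the plane of
  \<open>e1\<close>, \<open>e2\<close> as d times a quarter turn. It is a derivation, so [c, x] and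
  [c, y] are multiplication by the plane vectors c(a) and c(b); such operators carry the unit line
  into the plane and the plane into the unit line. Hence [c, x] c [c, y] - [c, y] c [c, x] lives on
  the unit line, where it is 2 d^4, while 2 c^4 is 2 d^4 on the plane. Together they give the scalar
  2 d^4 (\<open>w_at_rmult\<close>), which is 2 at \<open>e1\<close>, \<open>e2\<close>.

  By \<open>R_J2_eq_range\<close> this covers all evaluations on \<open>R_J2\<close>. These
  operators generate every endomorphism (\<open>M_J2_eq_UNIV\<close>), and in the full matrix
  algebra an explicit noncentral value (\<open>w_at_not_central\<close>) refutes centrality.
  \<open>eval_free_w_poly\<close> links the formal polynomial to these computations.\<close>

lemma poly_mapping_induct_add [case_names zero single add]:
  assumes "P 0" "\<And>k c. P (Poly_Mapping.single k c)" "\<And>p q. P p \<Longrightarrow> P q \<Longrightarrow> P (p + q)"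
  shows "P (p :: 'k \<Rightarrow>\<^sub>0 'v::monoid_add)"
proof (induction p rule: update_induct)
  case const
  show ?case by (fact assms(1))
next
  case (update f a b)
  have "Poly_Mapping.update a b f = f + Poly_Mapping.single a b"
    using update.hyps
    by (intro poly_mapping_eqI)
      (auto simp: lookup_update lookup_add lookup_single when_def in_keys_iff)
  then show ?case using assms update.IH by simp
qed

locale assoc_algebra = vector_space sc for sc :: "'f::field \<Rightarrow> 'r::ring_1 \<Rightarrow> 'r" +
  assumes sc_mult_left: "sc c a * b = sc c (a * b)"
    and sc_mult_right: "a * sc c b = sc c (a * b)"
begin

lemma eval_free_single:
  "eval_free sc \<phi> (Poly_Mapping.single u c) = sc c (prod_list (map \<phi> (letters u)))"
  by (simp add: eval_free_def)

lemma eval_free_zero: "eval_free sc \<phi> 0 = 0"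
  by (simp add: eval_free_def)

lemma eval_free_add: "eval_free sc \<phi> (p + q) = eval_free sc \<phi> p + eval_free sc \<phi> q"
  unfolding eval_free_def
  by (rule setsum_keys_plus_distrib) (simp_all add: scale_left_distrib)

lemma eval_free_diff: "eval_free sc \<phi> (p - q) = eval_free sc \<phi> p - eval_free sc \<phi> q"
  by (metis eval_free_add diff_add_cancel add_diff_cancel_right')

text \<open>Both sides are biadditive in \<open>p\<close> and \<open>q\<close>, so monomials
  suffice; there concatenation of words becomes multiplication of values.\<close>

lemma eval_free_mult: "eval_free sc \<phi> (p * q) = eval_free sc \<phi> p * eval_free sc \<phi> q"
proof (induction p rule: poly_mapping_induct_add)
  case (single u c)
  show ?case
  proof (induction q rule: poly_mapping_induct_add)
    case (single v d)
    show ?case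
      by (simp add: mult_single eval_free_single plus_word_def sc_mult_left sc_mult_right
          mult.commute)
  qed (simp_all add: eval_free_zero eval_free_add distrib_left)
qed (simp_all add: eval_free_zero eval_free_add distrib_right)

lemma eval_free_one: "eval_free sc \<phi> 1 = 1"
  by (simp add: eval_free_def lookup_one zero_word_def)

lemma eval_free_var: "eval_free sc \<phi> (var x) = \<phi> x"
  by (simp add: var_def eval_free_single)

lemma eval_free_comm:
  "eval_free sc \<phi> (comm p q) = comm (eval_free sc \<phi> p) (eval_free sc \<phi> q)"
  by (simp add: comm_def eval_free_diff eval_free_mult)

lemma eval_free_power: "eval_free sc \<phi> (p ^ n) = eval_free sc \<phi> p ^ n"
  by (induction n) (simp_all add: eval_free_one eval_free_mult)

lemma eval_free_two: "eval_free sc \<phi> 2 = 2"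
  by (metis eval_free_add eval_free_one one_add_one)

end

definition w_at :: "'r::ring_1 \<Rightarrow> 'r \<Rightarrow> 'r"
  where "w_at x y = (let c = comm x y in
    comm c x * c * comm c y - comm c y * c * comm c x + 2 * c ^ 4)"

lemma (in assoc_algebra) eval_free_w_poly:
  "eval_free sc \<phi> w_poly = w_at (\<phi> X) (\<phi> Y)"
  by (simp add: w_poly_def w_at_def Let_def eval_free_comm eval_free_add eval_free_diff
      eval_free_mult eval_free_power eval_free_two eval_free_var)

interpretation endo: assoc_algebra "scale_endo :: 'f::field \<Rightarrow> ('f, 'n::finite) endo \<Rightarrow> _"
  by standard
    (transfer; simp add: fun_eq_iff vec.linear_scale)+

section \<open>Homogeneous polynomials\<close>

text \<open>Zero is homogeneous of every degree, so cancellation in sums and differences needs no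
  care; nonvanishing is settled separately, by an evaluation.\<close>

definition homogeneous :: "nat \<Rightarrow> ('x, 'f::field) free_alg \<Rightarrow> bool"
  where "homogeneous n p \<longleftrightarrow> (\<forall>u\<in>Poly_Mapping.keys p. length (letters u) = n)"

lemma homogeneous_var: "homogeneous 1 (var x)"
  by (simp add: homogeneous_def var_def)

lemma homogeneous_add: "homogeneous n p \<Longrightarrow> homogeneous n q \<Longrightarrow> homogeneous n (p + q)"
  using keys_add [of p q] by (auto simp: homogeneous_def)

lemma homogeneous_diff: "homogeneous n p \<Longrightarrow> homogeneous n q \<Longrightarrow> homogeneous n (p - q)"
  by (auto simp: homogeneous_def in_keys_iff lookup_minus)

lemma homogeneous_mult:
  assumes "homogeneous m p" "homogeneous n q"
  shows "homogeneous (m + n) (p * q)"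
  unfolding homogeneous_def
proof
  fix u assume "u \<in> Poly_Mapping.keys (p * q)"
  then obtain v w where "v \<in> Poly_Mapping.keys p" "w \<in> Poly_Mapping.keys q" "u = v + w"
    using keys_mult [of p q] by blast
  then show "length (letters u) = m + n"
    using assms by (auto simp: homogeneous_def plus_word_def)
qed

lemma homogeneous_one: "homogeneous 0 1"
  by (simp add: homogeneous_def zero_word_def)

lemma homogeneous_power: "homogeneous n p \<Longrightarrow> homogeneous (k * n) (p ^ k)"
  by (induction k) (simp_all add: homogeneous_one homogeneous_mult)

lemma homogeneous_comm:
  assumes "homogeneous m p" "homogeneous n q"
  shows "homogeneous (m + n) (comm p q)"
  using homogeneous_mult [OF assms] homogeneous_mult [OF assms(2,1)]
  by (simp add: comm_def homogeneous_diff add.commute)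

lemma free_degree_homogeneous:
  assumes "homogeneous n p" "p \<noteq> 0"
  shows "free_degree p = n"
proof -
  have "(length \<circ> letters) ` Poly_Mapping.keys p = {n}"
    using assms unfolding homogeneous_def image_comp [symmetric]
    by (auto simp: image_iff simp flip: keys_eq_empty)
  then show ?thesis by (simp add: free_degree_def)
qed

lemma homogeneous_w_poly: "homogeneous 8 (w_poly :: (xy, 'f::field) free_alg)"
proof -
  define c :: "(xy, 'f) free_alg" where "c = comm (var X) (var Y)"
  have c: "homogeneous 2 c"
    using homogeneous_comm [OF homogeneous_var homogeneous_var] by (simp add: c_def numeral_2_eq_2)
  have cv: "homogeneous 3 (comm c (var z))" for z
    using homogeneous_comm [OF c homogeneous_var] by simp
  have "homogeneous (3 + 2 + 3) (comm c (var z) * c * comm c (var z'))" for z z'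
    by (intro homogeneous_mult c cv)
  moreover have "homogeneous 0 (2 :: (xy, 'f) free_alg)"
    using homogeneous_add [OF homogeneous_one homogeneous_one] by simp
  then have "homogeneous (0 + 4 * 2) (2 * c ^ 4)"
    by (intro homogeneous_mult homogeneous_power c)
  ultimately show ?thesis
    by (simp add: w_poly_def Let_def flip: c_def) (intro homogeneous_add homogeneous_diff; simp)
qed

section \<open>Endomorphisms as matrices\<close>

lift_definition mat_endo :: "'f::field ^ 'n::finite ^ 'n \<Rightarrow> ('f, 'n) endo" is "(*v)"
  by (rule matrix_vector_mul_linear_gen)

lemma mat_endo_mult: "mat_endo A * mat_endo B = mat_endo (A ** B)"
  by transfer (simp add: fun_eq_iff matrix_vector_mul_assoc)

lemma mat_endo_add: "mat_endo A + mat_endo B = mat_endo (A + B)"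
  by transfer (simp add: fun_eq_iff matrix_vector_mult_add_rdistrib)

lemma mat_endo_diff: "mat_endo A - mat_endo B = mat_endo (A - B)"
  by transfer (simp add: fun_eq_iff matrix_vector_mult_diff_rdistrib)

lemma mat_endo_scale: "scale_endo c (mat_endo A) = mat_endo (\<chi> i j. c * A $ i $ j)"
  by transfer
    (simp add: fun_eq_iff vec_eq_iff matrix_vector_mult_def sum_distrib_left mult.assoc)

lemma mat_endo_one: "mat_endo (mat 1) = 1"
  by transfer (simp add: fun_eq_iff)

lemma mat_endo_inject [simp]: "mat_endo A = mat_endo B \<longleftrightarrow> A = B"
  by transfer (simp add: matrix_eq fun_eq_iff)

lemma mat_endo_matrix: "mat_endo (matrix (apply_endo T)) = T"
  by transfer (simp add: fun_eq_iff matrix_works)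

lemma iso_matrix_algebra_UNIV:
  "iso_matrix_algebra (UNIV :: ('f::field, 'n::finite) endo set) TYPE('f ^ 'n ^ 'n)"
  unfolding iso_matrix_algebra_def
proof (intro exI [of _ "\<lambda>T :: ('f, 'n) endo. matrix (apply_endo T)"] conjI ballI allI)
  let ?\<Phi> = "\<lambda>T :: ('f, 'n) endo. matrix (apply_endo T)"
  \<comment> \<open>\<open>mat_endo\<close> is the two-sided inverse of \<open>?\<Phi>\<close>, so
    each algebra law for it transfers to \<open>?\<Phi>\<close>.\<close>
  have [simp]: "?\<Phi> (mat_endo A) = A" for A
    by (metis mat_endo_inject mat_endo_matrix)
  show "bij ?\<Phi>"
    by (rule bij_betw_byWitness [where f' = mat_endo]) (auto simp: mat_endo_matrix)
  show "?\<Phi> (S + T) = ?\<Phi> S + ?\<Phi> T" for S T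
    by (metis mat_endo_add mat_endo_inject mat_endo_matrix)
  show "?\<Phi> (scale_endo c T) = (\<chi> i j. c * ?\<Phi> T $ i $ j)" for c T
    by (metis mat_endo_scale mat_endo_inject mat_endo_matrix)
  show "?\<Phi> (S * T) = ?\<Phi> S ** ?\<Phi> T" for S T
    by (metis mat_endo_mult mat_endo_inject mat_endo_matrix)
qed

text \<open>Listing the entries by rows turns operator identities into polynomial identities over
  the field.\<close>

definition mat3 :: "'f \<Rightarrow> 'f \<Rightarrow> 'f \<Rightarrow> 'f \<Rightarrow> 'f \<Rightarrow> 'f \<Rightarrow> 'f \<Rightarrow> 'f \<Rightarrow> 'f \<Rightarrow> ('f::field, 3) endo"
  where "mat3 a b c d e f g h i =
    mat_endo (vector [vector [a, b, c], vector [d, e, f], vector [g, h, i]])"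

lemma mat3_mult:
  "mat3 a b c d e f g h i * mat3 a' b' c' d' e' f' g' h' i' =
    mat3 (a * a' + b * d' + c * g') (a * b' + b * e' + c * h') (a * c' + b * f' + c * i')
      (d * a' + e * d' + f * g') (d * b' + e * e' + f * h') (d * c' + e * f' + f * i')
      (g * a' + h * d' + i * g') (g * b' + h * e' + i * h') (g * c' + h * f' + i * i')"
  by (simp add: mat3_def mat_endo_mult vec_eq_iff forall_3 matrix_matrix_mult_def sum_3)

lemma mat3_add:
  "mat3 a b c d e f g h i + mat3 a' b' c' d' e' f' g' h' i' =
    mat3 (a + a') (b + b') (c + c') (d + d') (e + e') (f + f') (g + g') (h + h') (i + i')"
  by (simp add: mat3_def mat_endo_add vec_eq_iff forall_3)

lemma mat3_diff:
  "mat3 a b c d e f g h i - mat3 a' b' c' d' e' f' g' h' i' =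
    mat3 (a - a') (b - b') (c - c') (d - d') (e - e') (f - f') (g - g') (h - h') (i - i')"
  by (simp add: mat3_def mat_endo_diff vec_eq_iff forall_3)

lemma mat3_scale:
  "scale_endo k (mat3 a b c d e f g h i) =
    mat3 (k * a) (k * b) (k * c) (k * d) (k * e) (k * f) (k * g) (k * h) (k * i)"
  by (simp add: mat3_def mat_endo_scale vec_eq_iff forall_3)

lemma mat3_one: "1 = mat3 1 0 0 0 1 0 0 0 1"
  by (simp add: mat3_def mat_def vec_eq_iff forall_3 flip: mat_endo_one)

lemma mat3_two: "2 = mat3 2 0 0 0 2 0 0 0 2"
  unfolding one_add_one [symmetric] by (simp add: mat3_one mat3_add)

lemma mat3_inject:
  "mat3 a b c d e f g h i = mat3 a' b' c' d' e' f' g' h' i' \<longleftrightarrow>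
    a = a' \<and> b = b' \<and> c = c' \<and> d = d' \<and> e = e' \<and> f = f' \<and> g = g' \<and> h = h' \<and> i = i'"
  by (auto simp: mat3_def vec_eq_iff forall_3)

lemma mat3_cases:
  obtains a b c d e f g h i where "T = mat3 a b c d e f g h i"
proof
  let ?A = "matrix (apply_endo T)"
  have "?A = vector [vector [?A $ 1 $ 1, ?A $ 1 $ 2, ?A $ 1 $ 3],
      vector [?A $ 2 $ 1, ?A $ 2 $ 2, ?A $ 2 $ 3], vector [?A $ 3 $ 1, ?A $ 3 $ 2, ?A $ 3 $ 3]]"
    by (simp add: vec_eq_iff forall_3)
  then show "T = mat3 (?A $ 1 $ 1) (?A $ 1 $ 2) (?A $ 1 $ 3) (?A $ 2 $ 1) (?A $ 2 $ 2)
      (?A $ 2 $ 3) (?A $ 3 $ 1) (?A $ 3 $ 2) (?A $ 3 $ 3)"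
    by (metis mat3_def mat_endo_matrix)
qed

section \<open>The multiplication algebra\<close>

lemma rmult_eq_mat3:
  "rmult a = mat3 (a $ 1) (a $ 2) (a $ 3) (a $ 2) (a $ 1) 0 (a $ 3) 0 (a $ 1)"
  unfolding mat3_def
  by transfer
    (simp add: fun_eq_iff vec_eq_iff forall_3 jmult_def matrix_vector_mult_def sum_3 algebra_simps)

text \<open>\<open>rmult a\<close> is linear in \<open>a\<close>, so its range is already a
  subspace.\<close>

lemma R_J2_eq_range: "R_J2 = (range rmult :: ('f::field, 3) endo set)"
proof -
  have "endo.subspace (range rmult :: ('f, 3) endo set)"
  proof (rule endo.subspaceI)
    show "0 \<in> range rmult"
      by (rule range_eqI [of _ _ 0], transfer)
        (simp add: fun_eq_iff jmult_def vec_eq_iff forall_3)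
  next
    fix S T :: "('f, 3) endo" assume "S \<in> range rmult" "T \<in> range rmult"
    then obtain a b where "S = rmult a" "T = rmult b" by blast
    then have "S + T = rmult (a + b)" by (simp add: rmult_eq_mat3 mat3_add)
    then show "S + T \<in> range rmult" by blast
  next
    fix k and T :: "('f, 3) endo" assume "T \<in> range rmult"
    then obtain a where "T = rmult a" by blast
    then have "scale_endo k T = rmult (k *s a)" by (simp add: rmult_eq_mat3 mat3_scale)
    then show "scale_endo k T \<in> range rmult" by blast
  qed
  then show ?thesis
    unfolding R_J2_def by (simp add: endo.span_eq_iff)
qed

lemma M_J2_eq_UNIV: "M_J2 = (UNIV :: ('f::field, 3) endo set)"
proof -
  have "T \<in> A" if A: "subalgebra scale_endo A" "R_J2 \<subseteq> A" for A and T :: "('f, 3) endo"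
  proof -
    have add: "U + V \<in> A" and diff: "U - V \<in> A" and mult: "U * V \<in> A"
      if "U \<in> A" "V \<in> A" for U V
      using that A(1)
      by (auto simp: subalgebra_def endo.subspace_add endo.subspace_diff)
    have scale: "scale_endo k U \<in> A" if "U \<in> A" for U k
      using that A(1) by (simp add: subalgebra_def endo.subspace_scale)
    define P Q :: "('f, 3) endo" where "P = rmult e1" and "Q = rmult e2"
    have I: "1 \<in> A" and P: "P \<in> A" and Q: "Q \<in> A"
    proof -
      have "1 = rmult (j_one :: 'f ^ 3)"
        by (simp add: rmult_eq_mat3 mat3_one j_one_def axis_def)
      then show "1 \<in> A" "P \<in> A" "Q \<in> A"
        using A(2) by (auto simp: R_J2_eq_range P_def Q_def)
    qed
    note ops = mat3_mult mat3_add mat3_diff mat3_scale mat3_one rmult_eq_mat3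
      e1_def e2_def axis_def P_def Q_def
    \<comment> \<open>Here P = E12 + E21 and Q = E13 + E31, so P P = E11 + E22 and Q Q = E11 + E33.
      This isolates the diagonal matrix units without dividing; multiplying E11 by P and Q yields
      the other six.\<close>
    define E1 where "E1 = P * P + Q * Q - 1"
    define E2 where "E2 = 1 - Q * Q"
    define E3 where "E3 = 1 - P * P"
    have E: "E1 \<in> A" "E2 \<in> A" "E3 \<in> A"
      unfolding E1_def E2_def E3_def by (intro add diff mult I P Q)+
    obtain a b c d e f g h i where T: "T = mat3 a b c d e f g h i"
      by (rule mat3_cases)
    have "T = scale_endo a E1 + scale_endo b (E1 * P) + scale_endo c (E1 * Q)
        + scale_endo d (P * E1) + scale_endo e E2 + scale_endo f (P * (E1 * Q))
        + scale_endo g (Q * E1) + scale_endo h (Q * (E1 * P)) + scale_endo i E3"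
      unfolding T E1_def E2_def E3_def by (simp add: ops)
    also have "\<dots> \<in> A"
      by (intro add scale mult E P Q)
    finally show ?thesis .
  qed
  then show ?thesis
    by (auto simp: M_J2_def generated_subalgebra_def hull_def)
qed

text \<open>The commutator of two multiplication operators is a multiple of the derivation
  \<open>e1 \<mapsto> - e2\<close>, \<open>e2 \<mapsto> e1\<close>, so its commutator with a multiplication operator is again a
  multiplication operator.\<close>

lemma w_at_rmult:
  "w_at (rmult a) (rmult b) = scale_endo (2 * (a $ 2 * b $ 3 - a $ 3 * b $ 2) ^ 4) 1"
proof -
  define d where "d = a $ 2 * b $ 3 - a $ 3 * b $ 2"
  define c where "c = mat3 0 0 0 0 0 d 0 (- d) 0"
  have c: "comm (rmult a) (rmult b) = c"
    by (simp add: comm_def c_def d_def rmult_eq_mat3 mat3_mult mat3_diff mat3_inject algebra_simps)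
  have cr: "comm c (rmult u) =
      mat3 0 (d * u $ 3) (- d * u $ 2) (d * u $ 3) 0 0 (- d * u $ 2) 0 0" for u
    by (simp add: comm_def c_def rmult_eq_mat3 mat3_mult mat3_diff mat3_inject algebra_simps)
  have c4: "c ^ 4 = mat3 0 0 0 0 (d ^ 4) 0 0 0 (d ^ 4)"
    by (simp add: c_def eval_nat_numeral mat3_mult mat3_inject algebra_simps)
  \<comment> \<open>In the corner entry three factors d come from the three uses of c; the fourth
    appears as the determinant of the coordinates of \<open>a\<close> and \<open>b\<close> and is
    folded into d afterwards.\<close>
  have "w_at (rmult a) (rmult b) =
      mat3 (2 * d ^ 3 * (a $ 2 * b $ 3 - a $ 3 * b $ 2)) 0 0 0 (2 * d ^ 4) 0 0 0 (2 * d ^ 4)"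
    unfolding w_at_def Let_def c cr c4
    by (simp add: c_def mat3_two mat3_mult mat3_add mat3_diff mat3_inject algebra_simps
        eval_nat_numeral)
  also have "\<dots> = scale_endo (2 * d ^ 4) 1"
    by (simp add: mat3_one mat3_scale mat3_inject eval_nat_numeral flip: d_def)
  finally show ?thesis by (simp add: d_def)
qed

lemma scale_endo_one_in_center: "scale_endo c 1 \<in> center_of UNIV"
  by (simp add: center_of_def endo.sc_mult_left endo.sc_mult_right)

text \<open>The witness \<open>x = E33\<close>, \<open>y = E21 + E23 + E32\<close> works in every characteristic because its
  \<open>(3, 1)\<close> entry is \<open>1\<close>; the simplest choice \<open>x = E12\<close>, \<open>y = E21\<close> gives \<open>6 (E11 + E22)\<close>, which
  vanishes in characteristic 3.\<close>

lemma w_at_not_central: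
  "w_at (mat3 0 0 0 0 0 0 0 0 1) (mat3 0 0 0 1 0 1 0 1 0) \<notin> center_of (UNIV :: ('f::field, 3) endo set)"
proof -
  have "w_at (mat3 0 0 0 0 0 0 0 0 1) (mat3 0 0 0 1 0 1 0 1 0) = mat3 0 0 0 0 6 0 1 0 (6 :: 'f)"
    by (simp add: w_at_def Let_def comm_def eval_nat_numeral mat3_mult mat3_add mat3_diff mat3_two
        mat3_inject)
  \<comment> \<open>Commuting with E11 would force the (3, 1) entry to vanish.\<close>
  moreover have "mat3 0 0 0 0 6 0 1 0 (6 :: 'f) * mat3 1 0 0 0 0 0 0 0 0
      \<noteq> mat3 1 0 0 0 0 0 0 0 0 * mat3 0 0 0 0 6 0 1 0 6"
    by (simp add: mat3_mult mat3_inject)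
  ultimately show ?thesis
    by (auto simp: center_of_def)
qed

theorem mainTheorem9:
  assumes "CHAR('f::field) \<noteq> 2"
  shows "free_degree (w_poly :: (xy, 'f) free_alg) = 8
    \<and> essential_weak_central scale_endo M_J2 R_J2 (w_poly :: (xy, 'f) free_alg)
    \<and> eval_free scale_endo (case_xy (rmult e1) (rmult e2)) (w_poly :: (xy, 'f) free_alg) = scale_endo 2 1
    \<and> iso_matrix_algebra (M_J2 :: ('f, 3) endo set) TYPE('f ^ 3 ^ 3)
    \<and> \<not> central_polynomial scale_endo M_J2 (w_poly :: (xy, 'f) free_alg)"
proof -
  let ?w = "w_poly :: (xy, 'f) free_alg"
  let ?\<epsilon> = "case_xy (rmult e1) (rmult e2) :: xy \<Rightarrow> ('f, 3) endo"
  \<comment> \<open>This makes the value at \<open>e1\<close>, \<open>e2\<close> nonzero, on which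
    both essentiality and the exact degree rest.\<close>
  have two: "(2 :: 'f) \<noteq> 0"
  proof
    assume "(2 :: 'f) = 0"
    then have "CHAR('f) dvd 2"
      by (metis of_nat_eq_0_iff_char_dvd of_nat_numeral)
    moreover from this have "CHAR('f) \<le> 2" "CHAR('f) \<noteq> 0"
      by (auto dest: dvd_imp_le intro!: Nat.gr0I)
    ultimately show False
      using assms CHAR_not_1' [where ?'a = 'f] by linarith
  qed
  have eval: "eval_free scale_endo ?\<epsilon> ?w = scale_endo 2 1"
    by (simp add: endo.eval_free_w_poly w_at_rmult e1_def e2_def axis_def)
  moreover have "scale_endo 2 1 \<noteq> (0 :: ('f, 3) endo)"
    using two by simp
  ultimately have eval_ne: "eval_free scale_endo ?\<epsilon> ?w \<noteq> 0"
    by simp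
  then have "?w \<noteq> 0"
    using endo.eval_free_zero by metis
  then have degree: "free_degree ?w = 8"
    by (intro free_degree_homogeneous homogeneous_w_poly)
  have "eval_free scale_endo \<phi> ?w \<in> center_of M_J2" if "range \<phi> \<subseteq> R_J2" for \<phi>
  proof -
    have "\<phi> X \<in> range rmult" "\<phi> Y \<in> range rmult"
      using that by (auto simp: R_J2_eq_range)
    then obtain a b where "\<phi> X = rmult a" "\<phi> Y = rmult b"
      by blast
    then show ?thesis
      by (simp add: endo.eval_free_w_poly w_at_rmult M_J2_eq_UNIV scale_endo_one_in_center)
  qed
  moreover have "range ?\<epsilon> \<subseteq> R_J2"
    by (auto simp: R_J2_eq_range split: xy.split)
  ultimately have weak: "essential_weak_central scale_endo M_J2 R_J2 ?w"
    using eval_ne unfolding essential_weak_central_def by blast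
  have "eval_free scale_endo (case_xy (mat3 0 0 0 0 0 0 0 0 1) (mat3 0 0 0 1 0 1 0 1 0)) ?w
      \<notin> center_of M_J2"
    using w_at_not_central by (simp add: endo.eval_free_w_poly M_J2_eq_UNIV)
  then have "\<not> central_polynomial scale_endo M_J2 ?w"
    unfolding central_polynomial_def essential_weak_central_def M_J2_eq_UNIV by blast
  then show ?thesis
    using degree weak eval iso_matrix_algebra_UNIV by (simp add: M_J2_eq_UNIV)
qed

end
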